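(* For every integer $k \ge 0$, there is an undirected Cayley graph on three generators of an Abelian (in fact, cyclic) group which has diameter $k$ and size (number of vertices) $n$, where $$n = \begin{cases} (32k^3+48k^2+54k+27)/27 & \text{if } k \equiv 0 \pmod 3,\\ (32k^3+48k^2+78k+31)/27 & \text{if } k \equiv 1 \pmod 3,\\ (32k^3+48k^2+54k+11)/27 & \text{if } k \equiv 2 \pmod 3.\end{cases}$$
   Context: Given an Abelian group $G$ (written additively) generated by a list of elements $g_1,\dots,g_d$ (repetitions and the identity are allowed), the undirected Cayley graph of $G$ on these $d$ generators has vertex set $G$, with $x$ and $y$ adjacent iff $y = x \pm g_i$ for some $i$. Its size is $|G|$. Its diameter is the maximum over pairs of vertices of the path distance, i.e. the least $k$ such that every element of $G$ is a sum of at most $k$ terms from $\{\pm g_1,\dots,\pm g_d\}$. *)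

theory Defs
  imports
    "HOL-Algebra.Elementary_Groups"
    "Graph_Theory.Pair_Digraph"
    "Graph_Theory.Shortest_Path"
begin

text \<open>
  Undirected graphs are represented by symmetric digraphs. A generator equal to the identity
  contributes only loops, and repeated generators contribute nothing new; neither affects distances.
\<close>

definition cayley_graph :: "('a, 'b) monoid_scheme \<Rightarrow> 'a list \<Rightarrow> ('a, 'a \<times> 'a) pre_digraph" where
  "cayley_graph G gs = with_proj
     \<lparr> pverts = carrier G,
       parcs = {(x, y). x \<in> carrier G \<and> y \<in> carrier G \<and>
                 (\<exists>g \<in> set gs. y = x \<otimes>\<^bsub>G\<^esub> g \<or> y = x \<otimes>\<^bsub>G\<^esub> inv\<^bsub>G\<^esub> g)} \<rparr>"

text \<open>
  With unit arc costs, \<open>wf_digraph.\<mu>\<close> is the least number of arcs of a walk, and is infinite if there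
  is no walk. The supremum is a maximum whenever the graph is finite and nonempty.
\<close>

definition graph_diameter :: "('a, 'b) pre_digraph \<Rightarrow> ereal" where
  "graph_diameter H = (SUP u \<in> verts H. SUP v \<in> verts H. wf_digraph.\<mu> H (\<lambda>_. 1) u v)"

lemma wf_digraph_cayley_graph: "wf_digraph (cayley_graph G gs)"
  by unfold_locales (auto simp: cayley_graph_def)

lemma symmetric_cayley_graph:
  assumes "group G" "set gs \<subseteq> carrier G"
  shows "symmetric (cayley_graph G gs)"
proof -
  interpret group G by fact
  have "x = x \<otimes>\<^bsub>G\<^esub> g \<otimes>\<^bsub>G\<^esub> inv\<^bsub>G\<^esub> g" "x = x \<otimes>\<^bsub>G\<^esub> inv\<^bsub>G\<^esub> g \<otimes>\<^bsub>G\<^esub> g"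
    if "x \<in> carrier G" "g \<in> set gs" for x g
    using that assms(2) by (auto simp: m_assoc subset_iff)
  then show ?thesis
    unfolding symmetric_def sym_def cayley_graph_def by fastforce
qed

end

theory Submission
  imports Defs
begin

text \<open>
  Put \<open>c = k div 3\<close> and \<open>a = k - c\<close>, so that \<open>2 c \<le> a \<le> 2 c + 2\<close>, and take the generators
  \<open>4 a\<^sup>2 + 1\<close>, \<open>2 a + 1\<close>, \<open>1 - 2 a\<close> of the integers modulo \<open>n = 4 a\<^sup>2 (2 c + 1) + 2 k + 1\<close>. The relations
  among them form a lattice in \<open>\<int>\<^sup>3\<close> that is close to a scaled body-centred cubic lattice, with
  \<open>(1, - 2 a, - 1)\<close>, \<open>(1, - 1, 2 a)\<close>, \<open>(2 c + 1, a, a)\<close> as a basis.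

  The diameter is at most \<open>k\<close> because every point of \<open>l\<^sub>1\<close>-norm \<open>k + 1\<close> is moved into the ball of radius \<open>k\<close>
  by one of finitely many short lattice vectors whose coordinates are linear in \<open>a\<close> and \<open>c\<close>; hence a
  word of any length can be shortened one letter at a time. It is at least \<open>k\<close> because
  \<open>(0, c, a)\<close> is a deep hole of the lattice.
\<close>

section \<open>The relation lattice and its short vectors\<close>

lemma l1_norm_triangle:
  fixes x y z u v w :: int
  shows "\<bar>x + u\<bar> + \<bar>y + v\<bar> + \<bar>z + w\<bar> \<le> (\<bar>x\<bar> + \<bar>y\<bar> + \<bar>z\<bar>) + (\<bar>u\<bar> + \<bar>v\<bar> + \<bar>w\<bar>)"
proof -
  have "\<bar>x + u\<bar> + \<bar>y + v\<bar> + \<bar>z + w\<bar> \<le> (\<bar>x\<bar> + \<bar>u\<bar>) + (\<bar>y\<bar> + \<bar>v\<bar>) + (\<bar>z\<bar> + \<bar>w\<bar>)"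
    by (intro add_mono abs_triangle_ineq)
  then show ?thesis by (simp only: ac_simps)
qed

text \<open>Evaluates an exponent vector at the three generators, before reduction. The relation
  lattice consists of the vectors whose value is a multiple of \<open>modulus a c\<close>.\<close>

definition residue_sum :: "int \<Rightarrow> int \<Rightarrow> int \<Rightarrow> int \<Rightarrow> int" where
  "residue_sum a x y z = (4 * a\<^sup>2 + 1) * x + (2 * a + 1) * y + (1 - 2 * a) * z"

text \<open>The absolute value of the determinant of the basis named above, that is, the index of
  the lattice it spans.\<close>

definition modulus :: "int \<Rightarrow> int \<Rightarrow> int" where
  "modulus a c = 4 * a\<^sup>2 * (2 * c + 1) + 2 * (a + c) + 1"

lemma residue_sum_diff:
  "residue_sum a (x - x') (y - y') (z - z') = residue_sum a x y z - residue_sum a x' y' z'"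
  by (simp add: residue_sum_def algebra_simps)

lemma residue_sum_uminus: "residue_sum a (- x) (- y) (- z) = - residue_sum a x y z"
  by (simp add: residue_sum_def algebra_simps)

text \<open>Meant for translating points with \<open>x \<ge> 0\<close>. This is why the vectors with
  first coordinate \<open>2 * c + 2\<close>, \<open>4 * c + 2\<close> and \<open>6 * c + 4\<close>
  occur with one sign only.\<close>

definition short_kernel :: "int \<Rightarrow> int \<Rightarrow> (int \<times> int \<times> int) set" where
  "short_kernel a c =
     {(1, - 2 * a, - 1), (- 1, 2 * a, 1), (1, - 1, 2 * a), (- 1, 1, - 2 * a),
      (4 * c + 2, 1, - 1), (2 * c + 1, a, a), (- 2 * c - 1, - a, - a),
      (2 * c + 2, - a, a - 1), (2 * c, a + 1, - a), (- 2 * c, - a - 1, a),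
      (2 * c + 1, 1 - a, - a - 1), (- 2 * c - 1, a - 1, a + 1), (6 * c + 4, 1 - a, a - 2)}"

lemma modulus_dvd_short_kernel:
  assumes "(u, v, w) \<in> short_kernel a c"
  shows "modulus a c dvd residue_sum a u v w"
proof -
  define n where "n = modulus a c"
  \<comment> \<open>First coordinate \<open>1\<close> or \<open>- 1\<close> gives value
    \<open>0\<close>, first coordinate \<open>4 * c + 2\<close> gives \<open>2 * n\<close>, and
    \<open>6 * c + 4\<close> gives \<open>3 * n\<close>; all others give \<open>n\<close> or
    \<open>- n\<close>.\<close>
  from assms have "residue_sum a u v w \<in> {0, n, - n, 2 * n, 3 * n}"
    unfolding short_kernel_def
    by (elim insertE emptyE Pair_inject; hypsubst;
        simp add: residue_sum_def n_def modulus_def algebra_simps power2_eq_square)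
  then show ?thesis unfolding n_def by auto
qed

text \<open>
  The vector \<open>(6 c + 4, 1 - a, a - 2)\<close> is needed only for \<open>a = 2\<close>, \<open>c = 0\<close>, at the point \<open>(3, 0, 0)\<close>.
\<close>

lemma short_kernel_reduces:
  fixes a c x y z :: int
  assumes "a \<ge> 1" "2 * c \<le> a" "a \<le> 2 * c + 2" "c \<ge> 0"
    and "x \<ge> 0" "\<bar>x\<bar> + \<bar>y\<bar> + \<bar>z\<bar> = a + c + 1"
  shows "\<exists>(u, v, w) \<in> short_kernel a c. \<bar>x - u\<bar> + \<bar>y - v\<bar> + \<bar>z - w\<bar> \<le> a + c"
proof -
  define near where "near u v w \<longleftrightarrow> \<bar>x - u\<bar> + \<bar>y - v\<bar> + \<bar>z - w\<bar> \<le> a + c" for u v w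
  \<comment> \<open>With \<open>x \<ge> 0\<close>, this splits the sphere into four octant faces, on
    each of which the norm is linear. Eight candidate vectors suffice for each face, which keeps the
    linear arithmetic small.\<close>
  consider "y \<ge> 0" "z \<ge> 0" | "y \<ge> 0" "z \<le> 0" | "y \<le> 0" "z \<ge> 0" | "y \<le> 0" "z \<le> 0"
    by linarith
  then have "near 1 (- 2 * a) (- 1) \<or> near (- 1) (2 * a) 1 \<or> near 1 (- 1) (2 * a) \<or>
    near (- 1) 1 (- 2 * a) \<or> near (4 * c + 2) 1 (- 1) \<or> near (2 * c + 1) a a \<or>
    near (- 2 * c - 1) (- a) (- a) \<or> near (2 * c + 2) (- a) (a - 1) \<or>
    near (2 * c) (a + 1) (- a) \<or> near (- 2 * c) (- a - 1) a \<or>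
    near (2 * c + 1) (1 - a) (- a - 1) \<or> near (- 2 * c - 1) (a - 1) (a + 1) \<or>
    near (6 * c + 4) (1 - a) (a - 2)"
  proof cases
    case 1
    with assms have "near (- 2 * c - 1) (a - 1) (a + 1) \<or> near (- 1) (2 * a) 1 \<or>
      near (2 * c + 1) a a \<or> near (2 * c + 2) (- a) (a - 1) \<or> near (2 * c) (a + 1) (- a) \<or>
      near 1 (- 1) (2 * a) \<or> near (4 * c + 2) 1 (- 1) \<or> near (6 * c + 4) (1 - a) (a - 2)"
      unfolding near_def by (smt (z3))
    then show ?thesis by blast
  next
    case 2
    with assms have "near (- 1) (2 * a) 1 \<or> near (- 1) 1 (- 2 * a) \<or>
      near (2 * c + 1) a a \<or> near (2 * c + 2) (- a) (a - 1) \<or> near (2 * c) (a + 1) (- a) \<or>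
      near (2 * c + 1) (1 - a) (- a - 1) \<or> near (4 * c + 2) 1 (- 1) \<or>
      near (6 * c + 4) (1 - a) (a - 2)"
      unfolding near_def by (smt (z3))
    then show ?thesis by blast
  next
    case 3
    with assms have "near (- 2 * c) (- a - 1) a \<or> near (- 2 * c - 1) (a - 1) (a + 1) \<or>
      near (2 * c + 1) a a \<or> near (2 * c + 2) (- a) (a - 1) \<or> near 1 (- 2 * a) (- 1) \<or>
      near 1 (- 1) (2 * a) \<or> near (4 * c + 2) 1 (- 1) \<or> near (6 * c + 4) (1 - a) (a - 2)"
      unfolding near_def by (smt (z3))
    then show ?thesis by blast
  next
    case 4
    with assms have "near (- 2 * c - 1) (- a) (- a) \<or> near (- 2 * c) (- a - 1) a \<or>
      near (- 1) 1 (- 2 * a) \<or> near (2 * c + 2) (- a) (a - 1) \<or>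
      near (2 * c + 1) (1 - a) (- a - 1) \<or> near 1 (- 2 * a) (- 1) \<or>
      near (4 * c + 2) 1 (- 1) \<or> near (6 * c + 4) (1 - a) (a - 2)"
      unfolding near_def by (smt (z3))
    then show ?thesis by blast
  qed
  then show ?thesis
    by (simp add: short_kernel_def near_def)
qed

section \<open>Covering all residues by the ball of radius \<open>a + c\<close>\<close>

text \<open>Lattice and norm are invariant under negation, so multiplying by a sign \<open>s\<close>
  reduces to a non-negative first coordinate.\<close>

lemma sphere_reduces:
  fixes a c x y z :: int
  assumes ac: "a \<ge> 1" "2 * c \<le> a" "a \<le> 2 * c + 2" "c \<ge> 0"
    and norm: "\<bar>x\<bar> + \<bar>y\<bar> + \<bar>z\<bar> = a + c + 1"
  obtains x' y' z' where "\<bar>x'\<bar> + \<bar>y'\<bar> + \<bar>z'\<bar> \<le> a + c"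
    "modulus a c dvd residue_sum a x y z - residue_sum a x' y' z'"
proof -
  define s :: int where "s = (if x \<ge> 0 then 1 else - 1)"
  have s: "s = 1 \<or> s = - 1" "s * x \<ge> 0" by (auto simp: s_def)
  then have "\<bar>s * x\<bar> + \<bar>s * y\<bar> + \<bar>s * z\<bar> = a + c + 1" using norm by auto
  from short_kernel_reduces[OF ac s(2) this] obtain u v w
    where uvw: "(u, v, w) \<in> short_kernel a c"
      and le: "\<bar>s * x - u\<bar> + \<bar>s * y - v\<bar> + \<bar>s * z - w\<bar> \<le> a + c"
    by auto
  show thesis
  proof
    have "\<bar>p - s * q\<bar> = \<bar>s * p - q\<bar>" for p q using s(1) by auto
    with le show "\<bar>x - s * u\<bar> + \<bar>y - s * v\<bar> + \<bar>z - s * w\<bar> \<le> a + c" by simp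
    have "modulus a c dvd residue_sum a (s * u) (s * v) (s * w)"
      using s(1) modulus_dvd_short_kernel[OF uvw] by (auto simp: residue_sum_uminus)
    then show "modulus a c dvd residue_sum a x y z - residue_sum a (x - s * u) (y - s * v) (z - s * w)"
      by (simp add: residue_sum_diff)
  qed
qed

text \<open>Remove one unit step, shorten the rest by induction, and add the step back: the result
  has norm at most \<open>a + c + 1\<close>, so at most one application of
  \<open>sphere_reduces\<close> is left.\<close>

lemma vector_reduces:
  fixes a c x y z :: int
  assumes ac: "a \<ge> 1" "2 * c \<le> a" "a \<le> 2 * c + 2" "c \<ge> 0"
  shows "\<exists>x' y' z'. \<bar>x'\<bar> + \<bar>y'\<bar> + \<bar>z'\<bar> \<le> a + c \<and>
    modulus a c dvd residue_sum a x y z - residue_sum a x' y' z'"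
proof (induction "nat (\<bar>x\<bar> + \<bar>y\<bar> + \<bar>z\<bar>)" arbitrary: x y z rule: less_induct)
  case less
  show ?case
  proof (cases "\<bar>x\<bar> + \<bar>y\<bar> + \<bar>z\<bar> \<le> a + c")
    case True
    then show ?thesis by (metis diff_self dvd_0_right)
  next
    case False
    have "\<exists>u v w. \<bar>x - u\<bar> + \<bar>y - v\<bar> + \<bar>z - w\<bar> < \<bar>x\<bar> + \<bar>y\<bar> + \<bar>z\<bar> \<and> \<bar>u\<bar> + \<bar>v\<bar> + \<bar>w\<bar> = 1"
    proof -
      consider "x \<noteq> 0" | "y \<noteq> 0" | "z \<noteq> 0" using False ac by fastforce
      then show ?thesis
      proof cases
        case 1 then show ?thesis
          by - (rule exI[of _ "sgn x"], rule exI[of _ 0], rule exI[of _ 0], auto simp: sgn_if)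
      next
        case 2 then show ?thesis
          by - (rule exI[of _ 0], rule exI[of _ "sgn y"], rule exI[of _ 0], auto simp: sgn_if)
      next
        case 3 then show ?thesis
          by - (rule exI[of _ 0], rule exI[of _ 0], rule exI[of _ "sgn z"], auto simp: sgn_if)
      qed
    qed
    then obtain u v w where uvw: "\<bar>x - u\<bar> + \<bar>y - v\<bar> + \<bar>z - w\<bar> < \<bar>x\<bar> + \<bar>y\<bar> + \<bar>z\<bar>"
      "\<bar>u\<bar> + \<bar>v\<bar> + \<bar>w\<bar> = 1" by blast
    then have "nat (\<bar>x - u\<bar> + \<bar>y - v\<bar> + \<bar>z - w\<bar>) < nat (\<bar>x\<bar> + \<bar>y\<bar> + \<bar>z\<bar>)"
      by (subst nat_less_eq_zless) simp_all
    from less[OF this] obtain x' y' z' where red: "\<bar>x'\<bar> + \<bar>y'\<bar> + \<bar>z'\<bar> \<le> a + c"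
      "modulus a c dvd residue_sum a (x - u) (y - v) (z - w) - residue_sum a x' y' z'" by blast
    have *: "modulus a c dvd residue_sum a x y z - residue_sum a (x' + u) (y' + v) (z' + w)"
      using red(2) by (simp add: residue_sum_def algebra_simps)
    have le: "\<bar>x' + u\<bar> + \<bar>y' + v\<bar> + \<bar>z' + w\<bar> \<le> a + c + 1"
      using add_mono[OF red(1) eq_refl[OF uvw(2)]] by (rule order_trans[OF l1_norm_triangle])
    show ?thesis
    proof (cases "\<bar>x' + u\<bar> + \<bar>y' + v\<bar> + \<bar>z' + w\<bar> \<le> a + c")
      case True
      with * show ?thesis by blast
    next
      case False
      with le have "\<bar>x' + u\<bar> + \<bar>y' + v\<bar> + \<bar>z' + w\<bar> = a + c + 1" by linarith
      from sphere_reduces[OF ac this] obtain x'' y'' z'' where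
        "\<bar>x''\<bar> + \<bar>y''\<bar> + \<bar>z''\<bar> \<le> a + c"
        "modulus a c dvd residue_sum a (x' + u) (y' + v) (z' + w) - residue_sum a x'' y'' z''" .
      moreover from dvd_add[OF * this(2)]
      have "modulus a c dvd residue_sum a x y z - residue_sum a x'' y'' z''" by simp
      ultimately show ?thesis by blast
    qed
  qed
qed

lemma residue_covered:
  fixes a c t :: int
  assumes ac: "2 * c \<le> a" "a \<le> 2 * c + 2" "c \<ge> 0"
  shows "\<exists>x y z. \<bar>x\<bar> + \<bar>y\<bar> + \<bar>z\<bar> \<le> a + c \<and> modulus a c dvd t - residue_sum a x y z"
proof (cases "a = 0")
  case True
  \<comment> \<open>This is \<open>k = 0\<close>, where \<open>c = 0\<close> too and the group is
    trivial; \<open>vector_reduces\<close> requires \<open>a \<ge> 1\<close>.\<close>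
  with ac have "modulus a c = 1" by (simp add: modulus_def)
  with ac show ?thesis by (intro exI[of _ 0]) simp
next
  case False
  \<comment> \<open>Bezout: \<open>(1 - a) * (2 * a + 1) - a * (1 - 2 * a) = 1\<close>, so the last
    two generators already reach every integer.\<close>
  have "residue_sum a 0 ((1 - a) * t) (- a * t) = t"
    by (simp add: residue_sum_def algebra_simps)
  with vector_reduces[of a c 0 "(1 - a) * t" "- a * t"] ac False show ?thesis by simp
qed

section \<open>The deep hole and the lower bound\<close>

lemma residue_far:
  fixes a c x y z :: int
  assumes ac: "2 * c \<le> a" "a \<le> 2 * c + 2" "c \<ge> 0"
    and dvd: "modulus a c dvd residue_sum a 0 c a - residue_sum a x y z"
  shows "a + c \<le> \<bar>x\<bar> + \<bar>y\<bar> + \<bar>z\<bar>"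
proof (rule ccontr)
  assume "\<not> ?thesis"
  then have less: "\<bar>x\<bar> + \<bar>y\<bar> + \<bar>z\<bar> \<le> a + c - 1" by simp
  then have a: "a \<ge> 1" using ac by linarith
  define b where "b = 2 * c + 1"
  define n where "n = modulus a c"
  have b: "b \<ge> 1" and n: "n = b * (4 * a\<^sup>2 + 1) + 2 * a"
    using ac by (simp_all add: b_def n_def modulus_def algebra_simps)
  \<comment> \<open>Sum and difference of the last two coordinates of the displacement from
    \<open>(0, c, a)\<close>. They suit the norm, since \<open>\<bar>y\<bar> + \<bar>z\<bar>\<close>
    is the maximum of \<open>\<bar>y + z\<bar>\<close> and \<open>\<bar>z - y\<bar>\<close>.\<close>
  define Y Z where "Y = y + z - (a + c)" and "Z = z - y - (a - c)"
  have "n dvd (4 * a\<^sup>2 + 1) * x + Y - 2 * a * Z"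
  proof -
    have "(4 * a\<^sup>2 + 1) * x + Y - 2 * a * Z = - (residue_sum a 0 c a - residue_sum a x y z)"
      by (simp add: Y_def Z_def residue_sum_def algebra_simps)
    with dvd show ?thesis unfolding n_def by (metis dvd_minus_iff)
  qed
  then obtain t where t: "(4 * a\<^sup>2 + 1) * x + Y - 2 * a * Z = n * t" by blast
  \<comment> \<open>\<open>t\<close>, \<open>s\<close> and \<open>Z\<close> determine the coordinates of \<open>(x, y - c, z - a)\<close> in the basis above; \<open>ns\<close> is
    Cramer's rule for \<open>s\<close>, sharp enough to force \<open>s = 0\<close>.\<close>
  define s where "s = x - b * t"
  have *: "2 * a * t = (4 * a\<^sup>2 + 1) * s + Y - 2 * a * Z"
    using t by (simp add: n s_def algebra_simps)
  have ns: "n * s = 2 * a * x - b * Y + 2 * a * b * Z"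
  proof -
    have "b * (2 * a * t) = b * ((4 * a\<^sup>2 + 1) * s + Y - 2 * a * Z)" using * by simp
    then show ?thesis by (simp add: n s_def algebra_simps)
  qed
  define q where "q = n * s"
  define K where "K = a + c - 1 - \<bar>x\<bar>"
  \<comment> \<open>The two shifted quantities are \<open>y + z\<close> and
    \<open>z - y\<close>.\<close>
  have YZ: "\<bar>Y + (a + c)\<bar> \<le> K" "\<bar>Z + (a - c)\<bar> \<le> K"
    using less by (auto simp: Y_def Z_def K_def)
  have ab: "a * b \<ge> a" using a b by (simp add: mult_le_cancel_left1)
  have bound: "\<bar>q + b * (2 * a * (a - c) - (a + c))\<bar> \<le> (2 * a * b + b) * (a + c - 1)"
  proof -
    have "q + b * (2 * a * (a - c) - (a + c))
        = 2 * a * x - b * (Y + (a + c)) + 2 * a * b * (Z + (a - c))"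
      using ns by (simp add: q_def algebra_simps)
    also have "\<bar>\<dots>\<bar> \<le> \<bar>2 * a * x\<bar> + \<bar>b * (Y + (a + c))\<bar> + \<bar>2 * a * b * (Z + (a - c))\<bar>"
      by linarith
    also have "\<dots> = 2 * a * \<bar>x\<bar> + b * \<bar>Y + (a + c)\<bar> + 2 * a * b * \<bar>Z + (a - c)\<bar>"
      using a b by (simp add: abs_mult)
    \<comment> \<open>Enlarging \<open>2 * a\<close> to \<open>2 * a * b\<close> lets
      \<open>\<bar>x\<bar>\<close> cancel against the \<open>\<bar>x\<bar>\<close> inside the last
      \<open>K\<close>.\<close>
    also have "\<dots> \<le> 2 * (a * b) * \<bar>x\<bar> + b * K + 2 * a * b * K"
      using a b ab YZ by (intro add_mono mult_left_mono mult_right_mono) auto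
    also have "\<dots> \<le> (2 * a * b + b) * (a + c - 1)"
      using b by (simp add: K_def algebra_simps)
    finally show ?thesis .
  qed
  have "n > 0" using a b by (simp add: n add_pos_pos)
  \<comment> \<open>By \<open>2 * c \<le> a\<close>, the upper bound on \<open>q\<close> has leading
    term \<open>2 * a * a * b\<close>, only half of that of \<open>n\<close>; but
    \<open>s \<ge> 1\<close> would give \<open>q \<ge> n\<close>.\<close>
  have "s \<le> 0"
  proof (rule ccontr)
    assume "\<not> s \<le> 0"
    then have "n \<le> q" using \<open>n > 0\<close> by (simp add: q_def)
    also have "q \<le> a * b * (2 * (2 * c - 1)) + b * (2 * a + 2 * c - 1)"
      using bound by (simp add: algebra_simps)
    also have "\<dots> \<le> a * b * (2 * (a - 1)) + b * (3 * a - 1)"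
      using a b ac by (intro add_mono mult_left_mono) auto
    also have "\<dots> = 2 * (a * (a * b)) + a * b - b"
      by (simp add: algebra_simps)
    finally have "4 * (a * (a * b)) + b + 2 * a \<le> 2 * (a * (a * b)) + a * b - b"
      by (simp add: n algebra_simps power2_eq_square)
    moreover have "a * b \<le> a * (a * b)" using a b by simp
    ultimately show False using a b ab by linarith
  qed
  \<comment> \<open>On this side both leading terms are \<open>4 * a * a * b\<close>, and the
    lower-order terms decide.\<close>
  moreover have "s \<ge> 0"
  proof (rule ccontr)
    assume "\<not> s \<ge> 0"
    then have "q \<le> n * (- 1)" unfolding q_def using \<open>n > 0\<close> by (intro mult_left_mono) auto
    then have "q \<le> - (4 * (a * (a * b)) + b + 2 * a)"
      by (simp add: n algebra_simps power2_eq_square)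
    moreover have "- q \<le> 4 * (a * (a * b)) - 2 * (a * b) - b"
      using bound by (simp add: algebra_simps)
    ultimately show False using a b ab by linarith
  qed
  ultimately have "s = 0" by simp
  then have x: "x = b * t" and Y: "Y = 2 * a * (t + Z)"
    using * by (simp_all add: s_def algebra_simps)
  show False
  proof (cases "t = 0")
    case True
    \<comment> \<open>Parity excludes odd \<open>Z\<close>, in particular \<open>Z = - 1\<close>,
      where \<open>y + z = c - a\<close> would be too small for a contradiction. With
      \<open>Z = 2 * e\<close>, the next value below \<open>a + c\<close> is
      \<open>c - 3 * a\<close>, whose absolute value is still at least \<open>a + c\<close>.\<close>
    have "even (Y - Z)" by (simp add: Y_def Z_def)
    moreover have "even Y" using Y by simp
    ultimately obtain e where "Z = 2 * e" by (auto elim: evenE)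
    with Y True have "y + z = a + c + 4 * (a * e)" by (simp add: Y_def algebra_simps)
    moreover have "e \<ge> 0 \<Longrightarrow> a * e \<ge> 0" using a by simp
    moreover have "e \<le> - 1 \<Longrightarrow> a * e \<le> a * (- 1)" using a by (intro mult_left_mono) auto
    ultimately show False using less ac a by (cases "e \<ge> 0") linarith+
  next
    case False
    \<comment> \<open>Here \<open>y + z\<close> may be \<open>c - a\<close>, but
      \<open>\<bar>x\<bar> \<ge> 2 * c + 1\<close> brings the norm up to at least
      \<open>a + c + 1\<close>.\<close>
    then have "b * 1 \<le> b * \<bar>t\<bar>" using b by (intro mult_left_mono) auto
    then have "\<bar>x\<bar> \<ge> 2 * c + 1" using b by (simp add: x abs_mult b_def)
    moreover define e where "e = t + Z"
    moreover have "y + z = a + c + 2 * (a * e)" using Y by (simp add: Y_def e_def algebra_simps)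
    moreover have "e \<ge> 0 \<Longrightarrow> a * e \<ge> 0" using a by simp
    moreover have "e \<le> - 1 \<Longrightarrow> a * e \<le> a * (- 1)" using a by (intro mult_left_mono) auto
    ultimately show False using less ac a by (cases "e \<ge> 0") linarith+
  qed
qed

section \<open>Walks in Cayley graphs of cyclic groups\<close>

lemma verts_cayley_graph_integer_mod_group:
  assumes "n > 0"
  shows "verts (cayley_graph (integer_mod_group n) gs) = {0..<int n}"
  using assms by (simp add: cayley_graph_def carrier_integer_mod_group)

text \<open>The carrier consists of least non-negative residues, so generators enter the graph
  reduced. Divisibility lets later arguments use the unreduced, possibly negative, integers.\<close>

lemma arcs_cayley_graph_integer_mod_group:
  assumes "n > 0"
  shows "arcs (cayley_graph (integer_mod_group n) (map (\<lambda>g. g mod int n) gs)) =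
    {(x, y). x \<in> {0..<int n} \<and> y \<in> {0..<int n} \<and>
      (\<exists>g \<in> set gs. int n dvd y - (x + g) \<or> int n dvd y - (x - g))}"
proof -
  have eq: "y = t mod int n \<longleftrightarrow> int n dvd y - t" if "y \<in> {0..<int n}" for y t
    using that by (metis atLeastLessThan_iff mod_eq_dvd_iff mod_pos_pos_trivial)
  have inv: "inv\<^bsub>integer_mod_group n\<^esub> (g mod int n) = (- g) mod int n" for g
    using assms by (simp add: carrier_integer_mod_group mod_minus_eq)
  have "arcs (cayley_graph (integer_mod_group n) (map (\<lambda>g. g mod int n) gs)) =
    {(x, y). x \<in> {0..<int n} \<and> y \<in> {0..<int n} \<and>
      (\<exists>g \<in> set gs. y = (x + g) mod int n \<or> y = (x - g) mod int n)}"
    using assms by (simp add: cayley_graph_def carrier_integer_mod_group inv mod_simps)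
  also have "\<dots> = {(x, y). x \<in> {0..<int n} \<and> y \<in> {0..<int n} \<and>
      (\<exists>g \<in> set gs. int n dvd y - (x + g) \<or> int n dvd y - (x - g))}"
    by (rule Collect_cong) (simp add: case_prod_beta eq cong: conj_cong)
  finally show ?thesis .
qed

text \<open>Every arc contributes one signed generator, and the triangle inequality bounds the norm
  of the accumulated coefficients.\<close>

lemma awalk_cayley_graph_imp_dvd:
  fixes g\<^sub>1 g\<^sub>2 g\<^sub>3 :: int
  defines "H \<equiv> \<lambda>n. cayley_graph (integer_mod_group n) (map (\<lambda>g. g mod int n) [g\<^sub>1, g\<^sub>2, g\<^sub>3])"
  assumes n: "n > 0" and "pre_digraph.awalk (H n) u p v"
  shows "\<exists>x y z. \<bar>x\<bar> + \<bar>y\<bar> + \<bar>z\<bar> \<le> int (length p) \<and>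
    int n dvd v - u - (x * g\<^sub>1 + y * g\<^sub>2 + z * g\<^sub>3)"
proof -
  interpret wf_digraph "H n" unfolding H_def by (rule wf_digraph_cayley_graph)
  from assms(3) show ?thesis
  proof (induction p arbitrary: u)
    case Nil
    then show ?case by (intro exI[of _ 0]) (simp add: awalk_Nil_iff)
  next
    case (Cons e p)
    then have e: "e \<in> arcs (H n)" "u = tail (H n) e" "awalk (head (H n) e) p v"
      by (simp_all add: awalk_Cons_iff)
    have th: "tail (H n) e = fst e" "head (H n) e = snd e" by (simp_all add: H_def cayley_graph_def)
    from Cons.IH[OF e(3)] obtain x y z where xyz: "\<bar>x\<bar> + \<bar>y\<bar> + \<bar>z\<bar> \<le> int (length p)"
      "int n dvd v - snd e - (x * g\<^sub>1 + y * g\<^sub>2 + z * g\<^sub>3)" unfolding th by blast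
    have "\<exists>i j k. \<bar>i\<bar> + \<bar>j\<bar> + \<bar>k\<bar> \<le> 1 \<and> int n dvd snd e - u - (i * g\<^sub>1 + j * g\<^sub>2 + k * g\<^sub>3)"
    proof -
      have "\<exists>g \<in> {g\<^sub>1, g\<^sub>2, g\<^sub>3}. int n dvd snd e - (u + g) \<or> int n dvd snd e - (u - g)"
        using e(1,2) unfolding H_def arcs_cayley_graph_integer_mod_group[OF n] th[unfolded H_def]
        by (auto simp: th)
      then consider "int n dvd snd e - u - (1 * g\<^sub>1 + 0 * g\<^sub>2 + 0 * g\<^sub>3)"
        | "int n dvd snd e - u - (- 1 * g\<^sub>1 + 0 * g\<^sub>2 + 0 * g\<^sub>3)"
        | "int n dvd snd e - u - (0 * g\<^sub>1 + 1 * g\<^sub>2 + 0 * g\<^sub>3)"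
        | "int n dvd snd e - u - (0 * g\<^sub>1 + - 1 * g\<^sub>2 + 0 * g\<^sub>3)"
        | "int n dvd snd e - u - (0 * g\<^sub>1 + 0 * g\<^sub>2 + 1 * g\<^sub>3)"
        | "int n dvd snd e - u - (0 * g\<^sub>1 + 0 * g\<^sub>2 + - 1 * g\<^sub>3)"
        by (auto simp: algebra_simps)
      then show ?thesis 
        by cases (rule exI, rule exI, rule exI, rule conjI[rotated], assumption, simp)+
    qed
    then obtain i j k where ijk: "\<bar>i\<bar> + \<bar>j\<bar> + \<bar>k\<bar> \<le> 1"
      "int n dvd snd e - u - (i * g\<^sub>1 + j * g\<^sub>2 + k * g\<^sub>3)" by blast
    show ?case
    proof (intro exI conjI)
      show "\<bar>x + i\<bar> + \<bar>y + j\<bar> + \<bar>z + k\<bar> \<le> int (length (e # p))"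
        using add_mono[OF xyz(1) ijk(1)] by (intro order_trans[OF l1_norm_triangle]) simp
      show "int n dvd v - u - ((x + i) * g\<^sub>1 + (y + j) * g\<^sub>2 + (z + k) * g\<^sub>3)"
        using dvd_add[OF xyz(2) ijk(2)] by (simp add: algebra_simps)
    qed
  qed
qed

text \<open>The group is commutative, so the letters may be spent in any order: step along a
  generator with non-zero coefficient and move that coefficient towards \<open>0\<close>.\<close>

lemma dvd_imp_awalk_cayley_graph:
  fixes g\<^sub>1 g\<^sub>2 g\<^sub>3 :: int
  defines "H \<equiv> \<lambda>n. cayley_graph (integer_mod_group n) (map (\<lambda>g. g mod int n) [g\<^sub>1, g\<^sub>2, g\<^sub>3])"
  assumes n: "n > 0" and v: "v \<in> {0..<int n}" and "u \<in> {0..<int n}"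
    and "\<bar>x\<bar> + \<bar>y\<bar> + \<bar>z\<bar> \<le> int r" "int n dvd v - u - (x * g\<^sub>1 + y * g\<^sub>2 + z * g\<^sub>3)"
  shows "\<exists>p. pre_digraph.awalk (H n) u p v \<and> length p \<le> r"
proof -
  interpret wf_digraph "H n" unfolding H_def by (rule wf_digraph_cayley_graph)
  have th: "tail (H n) = fst" "head (H n) = snd" by (simp_all add: H_def cayley_graph_def)
  from assms(4-) show ?thesis
  proof (induction r arbitrary: u x y z)
    case 0
    then have "x = 0" "y = 0" "z = 0" by simp_all
    with 0 have "int n dvd v - u" by simp
    then have "u = v" using v 0(1) by (metis atLeastLessThan_iff mod_eq_dvd_iff mod_pos_pos_trivial)
    moreover have "v \<in> verts (H n)" using v n by (simp add: H_def verts_cayley_graph_integer_mod_group)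
    ultimately show ?case by (auto simp: awalk_Nil_iff)
  next
    case (Suc r)
    show ?case
    proof (cases "\<bar>x\<bar> + \<bar>y\<bar> + \<bar>z\<bar> \<le> int r")
      \<comment> \<open>Slack in the bound is given up first, so that a letter is removed only when
        the norm is exactly \<open>Suc r\<close>.\<close>
      case True
      from Suc.IH[OF Suc.prems(1) this Suc.prems(3)] show ?thesis using le_SucI by blast
    next
      case False
      have "\<exists>g s x' y' z'. g \<in> {g\<^sub>1, g\<^sub>2, g\<^sub>3} \<and> (s = 1 \<or> s = - 1) \<and> \<bar>x'\<bar> + \<bar>y'\<bar> + \<bar>z'\<bar> \<le> int r \<and>
        x * g\<^sub>1 + y * g\<^sub>2 + z * g\<^sub>3 = s * g + (x' * g\<^sub>1 + y' * g\<^sub>2 + z' * g\<^sub>3)"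
      proof -
        consider "x \<noteq> 0" | "y \<noteq> 0" | "z \<noteq> 0" using False by fastforce
        then show ?thesis
        proof cases
          case 1 then show ?thesis using Suc.prems(2)
            by - (rule exI[of _ g\<^sub>1], rule exI[of _ "sgn x"], rule exI[of _ "x - sgn x"], rule exI[of _ y],
              rule exI[of _ z], auto simp: sgn_if algebra_simps)
        next
          case 2 then show ?thesis using Suc.prems(2)
            by - (rule exI[of _ g\<^sub>2], rule exI[of _ "sgn y"], rule exI[of _ x], rule exI[of _ "y - sgn y"],
              rule exI[of _ z], auto simp: sgn_if algebra_simps)
        next
          case 3 then show ?thesis using Suc.prems(2)
            by - (rule exI[of _ g\<^sub>3], rule exI[of _ "sgn z"], rule exI[of _ x], rule exI[of _ y],
              rule exI[of _ "z - sgn z"], auto simp: sgn_if algebra_simps)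
        qed
      qed
      then obtain g s x' y' z' where g: "g \<in> {g\<^sub>1, g\<^sub>2, g\<^sub>3}" "s = 1 \<or> s = - 1"
        and r: "\<bar>x'\<bar> + \<bar>y'\<bar> + \<bar>z'\<bar> \<le> int r"
        and eq: "x * g\<^sub>1 + y * g\<^sub>2 + z * g\<^sub>3 = s * g + (x' * g\<^sub>1 + y' * g\<^sub>2 + z' * g\<^sub>3)" by blast
      define u' where "u' = (u + s * g) mod int n"
      have u': "u' \<in> {0..<int n}" using n by (simp add: u'_def)
      have d: "int n dvd u' - (u + s * g)" unfolding u'_def by (simp add: mod_eq_dvd_iff[symmetric])
      then have "(u, u') \<in> arcs (H n)"
        unfolding H_def arcs_cayley_graph_integer_mod_group[OF n] using g u' Suc.prems(1) by auto
      moreover have "int n dvd v - u' - (x' * g\<^sub>1 + y' * g\<^sub>2 + z' * g\<^sub>3)"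
        using dvd_diff[OF Suc.prems(3) d] unfolding eq by (simp add: algebra_simps)
      from Suc.IH[OF u' r this] obtain p where "awalk u' p v" "length p \<le> r" by blast
      ultimately have "awalk u ((u, u') # p) v \<and> length ((u, u') # p) \<le> Suc r"
        by (simp add: awalk_Cons_iff th)
      then show ?thesis by blast
    qed
  qed
qed

text \<open>Distances depend only on the difference of the end points. So \<open>cover\<close>,
  applied to \<open>v - u\<close>, bounds every distance, while the single residue \<open>t\<close>
  of \<open>far\<close> supplies the distant pair \<open>0\<close> and
  \<open>t mod int n\<close>.\<close>

lemma graph_diameter_cayley_graph_integer_mod_group:
  fixes g\<^sub>1 g\<^sub>2 g\<^sub>3 :: int
  assumes n: "n > 0"
    and cover: "\<And>t. \<exists>x y z. \<bar>x\<bar> + \<bar>y\<bar> + \<bar>z\<bar> \<le> int k \<and> int n dvd t - (x * g\<^sub>1 + y * g\<^sub>2 + z * g\<^sub>3)"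
    and far: "\<And>x y z. int n dvd t - (x * g\<^sub>1 + y * g\<^sub>2 + z * g\<^sub>3) \<Longrightarrow> int k \<le> \<bar>x\<bar> + \<bar>y\<bar> + \<bar>z\<bar>"
  shows "graph_diameter (cayley_graph (integer_mod_group n) (map (\<lambda>g. g mod int n) [g\<^sub>1, g\<^sub>2, g\<^sub>3])) =
    ereal (real k)"
    (is "graph_diameter ?H = _")
proof -
  interpret wf_digraph ?H by (rule wf_digraph_cayley_graph)
  have verts: "verts ?H = {0..<int n}" by (rule verts_cayley_graph_integer_mod_group[OF n])
  have cost: "awalk_cost (\<lambda>_. 1) p = real (length p)" for p
    by (simp add: awalk_cost_def sum_list_triv)
  have "\<mu> (\<lambda>_. 1) u v \<le> ereal (real k)" if uv: "u \<in> verts ?H" "v \<in> verts ?H" for u v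
  proof -
    from cover[of "v - u"] obtain p where p: "awalk u p v" "length p \<le> k"
      using dvd_imp_awalk_cayley_graph[OF n] uv unfolding verts by metis
    have "\<mu> (\<lambda>_. 1) u v \<le> ereal (awalk_cost (\<lambda>_. 1) p)" by (rule min_cost_le_walk_cost[OF p(1)])
    also have "\<dots> \<le> ereal (real k)" using p(2) by (simp add: cost)
    finally show ?thesis .
  qed
  then have "graph_diameter ?H \<le> ereal (real k)"
    unfolding graph_diameter_def by (intro SUP_least)
  moreover have "ereal (real k) \<le> \<mu> (\<lambda>_. 1) 0 (t mod int n)"
    unfolding \<mu>_def
  proof (intro INF_greatest, clarify)
    fix p assume "awalk 0 p (t mod int n)"
    from awalk_cayley_graph_imp_dvd[OF n this] obtain x y z where
      xyz: "\<bar>x\<bar> + \<bar>y\<bar> + \<bar>z\<bar> \<le> int (length p)" "int n dvd t mod int n - (x * g\<^sub>1 + y * g\<^sub>2 + z * g\<^sub>3)"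
      by auto
    then have "int n dvd t - (x * g\<^sub>1 + y * g\<^sub>2 + z * g\<^sub>3)"
      by (simp add: mod_eq_dvd_iff[symmetric])
    from far[OF this] xyz(1) show "ereal (real k) \<le> ereal (awalk_cost (\<lambda>_. 1) p)"
      by (simp add: cost)
  qed
  then have "ereal (real k) \<le> graph_diameter ?H"
    unfolding graph_diameter_def verts using n by (intro SUP_upper2[of 0] SUP_upper2[of "t mod int n"]) auto
  ultimately show ?thesis by (rule antisym)
qed

section \<open>Cyclicity, generation and the number of vertices\<close>

lemma cyclic_group_integer_mod_group:
  assumes "n > 0"
  shows "cyclic_group (integer_mod_group n)" (is "cyclic_group ?G")
proof -
  \<comment> \<open>The generator is written \<open>1 mod int n\<close> so that the trivial group
    \<open>n = 1\<close>, where it is \<open>0\<close>, is included.\<close>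
  have "{0..<int n} = range (\<lambda>m. m * (1 mod int n) mod int n)"
  proof
    show "{0..<int n} \<subseteq> range (\<lambda>m. m * (1 mod int n) mod int n)"
    proof
      fix m assume "m \<in> {0..<int n}"
      then have "m = m * (1 mod int n) mod int n" by (simp add: mod_mult_right_eq)
      then show "m \<in> range (\<lambda>m. m * (1 mod int n) mod int n)" by blast
    qed
  qed (use assms in auto)
  then have "carrier ?G = range (\<lambda>m::int. (1 mod int n) [^]\<^bsub>?G\<^esub> m)"
    using assms by (simp add: carrier_integer_mod_group int_pow_integer_mod_group)
  moreover have "1 mod int n \<in> carrier ?G"
    using assms by (simp add: carrier_integer_mod_group)
  ultimately show ?thesis
    using group.cyclic_group[OF group_integer_mod_group] by blast
qed

lemma generate_integer_mod_group:
  fixes g\<^sub>1 g\<^sub>2 g\<^sub>3 :: int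
  assumes n: "n > 0"
    and cover: "\<And>t. \<exists>x y z. int n dvd t - (x * g\<^sub>1 + y * g\<^sub>2 + z * g\<^sub>3)"
  shows "generate (integer_mod_group n) {g\<^sub>1 mod int n, g\<^sub>2 mod int n, g\<^sub>3 mod int n} =
    carrier (integer_mod_group n)"
    (is "generate ?G ?A = _")
proof -
  interpret group ?G by simp
  have A: "?A \<subseteq> carrier ?G" using n by (simp add: carrier_integer_mod_group)
  then have sub: "subgroup (generate ?G ?A) ?G" by (rule generate_is_subgroup)
  have "t \<in> generate ?G ?A" if t: "t \<in> carrier ?G" for t
  proof -
    from cover obtain x y z where "int n dvd t - (x * g\<^sub>1 + y * g\<^sub>2 + z * g\<^sub>3)" by blast
    then have "t mod int n = (x * g\<^sub>1 + y * g\<^sub>2 + z * g\<^sub>3) mod int n" by (simp add: mod_eq_dvd_iff)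
    then have "t = (g\<^sub>1 mod int n) [^]\<^bsub>?G\<^esub> x \<otimes>\<^bsub>?G\<^esub> (g\<^sub>2 mod int n) [^]\<^bsub>?G\<^esub> y \<otimes>\<^bsub>?G\<^esub> (g\<^sub>3 mod int n) [^]\<^bsub>?G\<^esub> z"
      using t n by (simp add: carrier_integer_mod_group int_pow_integer_mod_group mod_simps)
    also have "\<dots> \<in> generate ?G ?A"
      by (intro subgroup.m_closed[OF sub] subgroup_int_pow_closed[OF sub] generate.incl) auto
    finally show ?thesis .
  qed
  then show ?thesis using generate_incl[OF A] by blast
qed

theorem theorem15:
  fixes k :: nat
  shows "\<exists>(G :: int monoid) g\<^sub>1 g\<^sub>2 g\<^sub>3.
    comm_group G \<and> cyclic_group G \<and>
    {g\<^sub>1, g\<^sub>2, g\<^sub>3} \<subseteq> carrier G \<and> generate G {g\<^sub>1, g\<^sub>2, g\<^sub>3} = carrier G \<and>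
    graph_diameter (cayley_graph G [g\<^sub>1, g\<^sub>2, g\<^sub>3]) = ereal (real k) \<and>
    real (card (verts (cayley_graph G [g\<^sub>1, g\<^sub>2, g\<^sub>3]))) =
      (if k mod 3 = 0 then (32 * real k ^ 3 + 48 * real k ^ 2 + 54 * real k + 27) / 27
       else if k mod 3 = 1 then (32 * real k ^ 3 + 48 * real k ^ 2 + 78 * real k + 31) / 27
       else (32 * real k ^ 3 + 48 * real k ^ 2 + 54 * real k + 11) / 27)"
proof -
  \<comment> \<open>Writing \<open>k = 3 * c + r\<close> with \<open>r \<le> 2\<close> gives
    \<open>a = 2 * c + r\<close>, hence the bounds in \<open>ac\<close>.\<close>
  define c a where "c = int (k div 3)" and "a = int k - c"
  have ac: "2 * c \<le> a" "a \<le> 2 * c + 2" "c \<ge> 0" and k: "a + c = int k"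
    unfolding a_def c_def by linarith+
  define n where "n = nat (modulus a c)"
  have "modulus a c > 0" using ac by (simp add: modulus_def add_nonneg_pos)
  then have n: "n > 0" and int_n: "int n = modulus a c" by (simp_all add: n_def)
  define g\<^sub>1 g\<^sub>2 g\<^sub>3 where "g\<^sub>1 = 4 * a\<^sup>2 + 1" and "g\<^sub>2 = 2 * a + 1" and "g\<^sub>3 = 1 - 2 * a"
  have sum: "residue_sum a x y z = x * g\<^sub>1 + y * g\<^sub>2 + z * g\<^sub>3" for x y z
    by (simp add: residue_sum_def g\<^sub>1_def g\<^sub>2_def g\<^sub>3_def mult.commute)
  have cover: "\<exists>x y z. \<bar>x\<bar> + \<bar>y\<bar> + \<bar>z\<bar> \<le> int k \<and> int n dvd t - (x * g\<^sub>1 + y * g\<^sub>2 + z * g\<^sub>3)" for t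
    using residue_covered[OF ac, of t] unfolding sum k int_n .
  \<comment> \<open>The distant residue is the image of the deep hole \<open>(0, c, a)\<close>,
    whose own norm is \<open>k\<close>.\<close>
  have far: "int k \<le> \<bar>x\<bar> + \<bar>y\<bar> + \<bar>z\<bar>"
    if "int n dvd residue_sum a 0 c a - (x * g\<^sub>1 + y * g\<^sub>2 + z * g\<^sub>3)" for x y z
    using residue_far[OF ac, of x y z] that unfolding k int_n by (simp add: sum)
  let ?G = "integer_mod_group n"
  let ?g\<^sub>1 = "g\<^sub>1 mod int n" and ?g\<^sub>2 = "g\<^sub>2 mod int n" and ?g\<^sub>3 = "g\<^sub>3 mod int n"
  have "graph_diameter (cayley_graph ?G [?g\<^sub>1, ?g\<^sub>2, ?g\<^sub>3]) = ereal (real k)"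
    using graph_diameter_cayley_graph_integer_mod_group[OF n cover far] by simp
  moreover have "generate ?G {?g\<^sub>1, ?g\<^sub>2, ?g\<^sub>3} = carrier ?G"
    using cover by (intro generate_integer_mod_group[OF n]) blast
  moreover have "real (card (verts (cayley_graph ?G [?g\<^sub>1, ?g\<^sub>2, ?g\<^sub>3]))) =
      (if k mod 3 = 0 then (32 * real k ^ 3 + 48 * real k ^ 2 + 54 * real k + 27) / 27
       else if k mod 3 = 1 then (32 * real k ^ 3 + 48 * real k ^ 2 + 78 * real k + 31) / 27
       else (32 * real k ^ 3 + 48 * real k ^ 2 + 54 * real k + 11) / 27)"
  proof -
    define m where "m = k div 3"
    have "real (card (verts (cayley_graph ?G [?g\<^sub>1, ?g\<^sub>2, ?g\<^sub>3]))) = of_int (int n)"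
      using n by (simp add: verts_cayley_graph_integer_mod_group)
    also have "\<dots> = 4 * (real k - real m)\<^sup>2 * (2 * real m + 1) + 2 * real k + 1"
      unfolding int_n by (simp add: modulus_def a_def c_def m_def)
    finally have card: "real (card (verts (cayley_graph ?G [?g\<^sub>1, ?g\<^sub>2, ?g\<^sub>3]))) =
      4 * (real k - real m)\<^sup>2 * (2 * real m + 1) + 2 * real k + 1" .
    \<comment> \<open>The three cubics are this one expression in \<open>k\<close> and
      \<open>m\<close>, with \<open>m\<close> eliminated according to the remainder of
      \<open>k\<close>.\<close>
    have "k = 3 * m + k mod 3" by (simp add: m_def)
    then have "real k = real (3 * m + k mod 3)" by (rule arg_cong)
    then have k_eq: "real k = 3 * real m + real (k mod 3)" by simp
    consider "k mod 3 = 0" | "k mod 3 = 1" | "k mod 3 = 2" by linarith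
    then show ?thesis
      by cases (simp_all add: card k_eq field_simps power2_eq_square power3_eq_cube)
  qed
  ultimately show ?thesis
    using n abelian_integer_mod_group cyclic_group_integer_mod_group[OF n]
    by - (rule exI[of _ ?G], rule exI[of _ ?g\<^sub>1], rule exI[of _ ?g\<^sub>2], rule exI[of _ ?g\<^sub>3],
      simp add: carrier_integer_mod_group)
qed

end
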